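(* Let an explicit SSP Runge--Kutta method with $s$ stages and SSP coefficient $\mathcal{C}>0$ be given in canonical Shu--Osher form $\alpha,\beta$, and define $D_{\mathcal{C}}:=\{z\in\mathbb{C}:|z+\mathcal{C}|\le\mathcal{C}\}$. Then $$\mathcal{M}(\alpha,\beta,D_{\mathcal{C}})\le1.$$
   Context: An explicit $s$-stage Runge--Kutta method in Shu--Osher form is given by strictly lower triangular real $(s+1)\times(s+1)$ matrices $\alpha,\beta$, with $v_i=1-\sum_j\alpha_{ij}$: $$Y_i=v_iU_n+\sum_{j=1}^{i-1}\big(\alpha_{ij}Y_j+\tau\beta_{ij}F(Y_j)\big)\ (1\le i\le s+1),\qquad U_{n+1}=Y_{s+1}.$$ A strong stability preserving (SSP) Runge--Kutta method with SSP coefficient $\mathcal{C}$ can be written in canonical Shu--Osher form, meaning that $\alpha=\mathcal{C}\beta$, $\alpha_{ij}\ge0$ for all $i,j$, and all row sums of $\alpha$ are at most $1$. Write $\alpha_{1:s},\beta_{1:s}$ for the upper-left $s\times s$ blocks of $\alpha,\beta$, and $\alpha_{s+1},\beta_{s+1}$ for the row vectors of the first $s$ entries of their last rows. The internal stability functions are $$(Q_1(z),\dots,Q_s(z)):=(\alpha_{s+1}+z\beta_{s+1})(I_s-\alpha_{1:s}-z\beta_{1:s})^{-1},$$ and the maximum internal amplification factor with respect to $\mathcal{S}\subset\mathbb{C}$ is $\mathcal{M}(\alpha,\beta,\mathcal{S}):=\max_{1\le j\le s}\sup_{z\in\mathcal{S}}|Q_j(z)|$. *)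

theory Defs
  imports "HOL-Analysis.Analysis" "Jordan_Normal_Form.Determinant"
    "Jordan_Normal_Form.Gauss_Jordan_Elimination"
begin

text \<open>
  Matrices and vectors are indexed from 0, so the stages \<open>Y\<^sub>1, \<dots>, Y\<^sub>s\<close> correspond to the indices
  \<open>0, \<dots>, s - 1\<close>, and the row with index \<open>s\<close> produces the new approximation \<open>U\<^bsub>n+1\<^esub> = Y\<^bsub>s+1\<^esub>\<close>.
\<close>

definition strictly_lower_triangular :: "'a::zero mat \<Rightarrow> bool" where
  "strictly_lower_triangular A \<longleftrightarrow>
     (\<forall>i < dim_row A. \<forall>j < dim_col A. i \<le> j \<longrightarrow> A $$ (i, j) = 0)"

definition explicit_shu_osher :: "nat \<Rightarrow> real mat \<Rightarrow> real mat \<Rightarrow> bool" where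
  "explicit_shu_osher s \<alpha> \<beta> \<longleftrightarrow>
     \<alpha> \<in> carrier_mat (s + 1) (s + 1) \<and> \<beta> \<in> carrier_mat (s + 1) (s + 1) \<and>
     strictly_lower_triangular \<alpha> \<and> strictly_lower_triangular \<beta>"

text \<open>
  The condition on the row sums says that the coefficients \<open>v\<^sub>i = 1 - (\<Sum>j. \<alpha>\<^sub>i\<^sub>j)\<close> of \<open>U\<^sub>n\<close>
  are nonnegative.
\<close>

definition canonical_shu_osher :: "nat \<Rightarrow> real \<Rightarrow> real mat \<Rightarrow> real mat \<Rightarrow> bool" where
  "canonical_shu_osher s C \<alpha> \<beta> \<longleftrightarrow>
     explicit_shu_osher s \<alpha> \<beta> \<and>
     \<alpha> = C \<cdot>\<^sub>m \<beta> \<and>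
     (\<forall>i < s + 1. \<forall>j < s + 1. \<alpha> $$ (i, j) \<ge> 0) \<and>
     (\<forall>i < s + 1. (\<Sum>j < s + 1. \<alpha> $$ (i, j)) \<le> 1)"

definition stage_block :: "nat \<Rightarrow> real mat \<Rightarrow> complex mat" where
  "stage_block s A = mat s s (\<lambda>(i, j). complex_of_real (A $$ (i, j)))"

definition last_row :: "nat \<Rightarrow> real mat \<Rightarrow> complex vec" where
  "last_row s A = vec s (\<lambda>j. complex_of_real (A $$ (s, j)))"

definition stage_matrix :: "nat \<Rightarrow> real mat \<Rightarrow> real mat \<Rightarrow> complex \<Rightarrow> complex mat" where
  "stage_matrix s \<alpha> \<beta> z = 1\<^sub>m s - stage_block s \<alpha> - z \<cdot>\<^sub>m stage_block s \<beta>"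

text \<open>
  For explicit methods the stage matrix is unit lower triangular, so that \<^const>\<open>mat_inverse\<close>
  really yields its inverse in the definition of the internal stability functions below.
\<close>

lemma det_stage_matrix:
  assumes "explicit_shu_osher s \<alpha> \<beta>"
  shows "det (stage_matrix s \<alpha> \<beta> z) = 1"
proof -
  have zero: "\<alpha> $$ (i, j) = 0" "\<beta> $$ (i, j) = 0" if "i \<le> j" "j < s" for i j
    using assms that
    by (auto simp: explicit_shu_osher_def strictly_lower_triangular_def)
  have carrier: "stage_matrix s \<alpha> \<beta> z \<in> carrier_mat s s"
    by (auto simp: stage_matrix_def stage_block_def)
  have "det (stage_matrix s \<alpha> \<beta> z) = prod_list (diag_mat (stage_matrix s \<alpha> \<beta> z))"
    by (rule det_lower_triangular[OF _ carrier])
       (auto simp: stage_matrix_def stage_block_def zero)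
  also have "diag_mat (stage_matrix s \<alpha> \<beta> z) = map (\<lambda>_. 1) [0..<s]"
    using carrier by (auto simp: diag_mat_def stage_matrix_def stage_block_def zero)
  finally show ?thesis
    by (simp add: map_replicate_const)
qed

lemma mat_inverse_stage_matrix:
  assumes "explicit_shu_osher s \<alpha> \<beta>"
  shows "mat_inverse (stage_matrix s \<alpha> \<beta> z) \<noteq> None"
proof -
  have carrier: "stage_matrix s \<alpha> \<beta> z \<in> carrier_mat s s"
    by (auto simp: stage_matrix_def stage_block_def)
  have "stage_matrix s \<alpha> \<beta> z \<in> Units (ring_mat TYPE(complex) s ())"
    by (rule det_non_zero_imp_unit[OF carrier]) (simp add: det_stage_matrix[OF assms])
  with mat_inverse(1)[OF carrier, where b = "()"] show ?thesis by blast
qed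

definition internal_stability_functions ::
    "nat \<Rightarrow> real mat \<Rightarrow> real mat \<Rightarrow> complex \<Rightarrow> complex vec" where
  "internal_stability_functions s \<alpha> \<beta> z =
     row (mat_of_row (last_row s \<alpha> + z \<cdot>\<^sub>v last_row s \<beta>)
          * the (mat_inverse (stage_matrix s \<alpha> \<beta> z))) 0"

text \<open>
  The supremum over an arbitrary set \<open>S\<close> may be infinite, hence the extended nonnegative reals.
  The maximum is only meaningful for \<open>s \<ge> 1\<close>.
\<close>

definition max_internal_amplification ::
    "nat \<Rightarrow> real mat \<Rightarrow> real mat \<Rightarrow> complex set \<Rightarrow> ennreal" where
  "max_internal_amplification s \<alpha> \<beta> S =
     Max ((\<lambda>j. SUP z\<in>S. ennreal (cmod (internal_stability_functions s \<alpha> \<beta> z $ j))) ` {..<s})"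

definition ssp_disk :: "real \<Rightarrow> complex set" where
  "ssp_disk C = {z. cmod (z + complex_of_real C) \<le> C}"

end

theory Submission
  imports Defs
begin

text \<open>
  In canonical form \<open>\<alpha> + z \<beta> = w \<alpha>\<close> with \<open>w = 1 + z / C\<close>, and \<open>z \<in> D\<^sub>C\<close> says exactly that
  \<open>\<bar>w\<bar> \<le> 1\<close>. So \<open>Q\<^sub>j(z)\<close> is the \<open>j\<close>-th entry of \<open>w \<alpha>\<^bsub>s+1\<^esub> (I - w \<alpha>\<^bsub>1:s\<^esub>)\<^sup>-\<^sup>1\<close>. For \<open>w = 1\<close> there
  is a probabilistic reading: the rows of \<open>\<alpha>\<close> are substochastic, so they describe a Markov chain
  (with killing) on the stages, and since \<open>\<alpha>\<close> is strictly lower triangular the chain only moves to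
  smaller indices and visits each stage at most once. Then \<open>Q\<^sub>j\<close> is the expected number of visits to
  \<open>j\<close> of the chain started in the last row, which is the probability of ever hitting \<open>j\<close>, hence at
  most 1.

  The proof for complex \<open>w\<close> follows this idea. The recursion for \<open>Q\<close> itself involves the column
  sums of \<open>\<alpha>\<close>, which may be large; therefore the bound is first established for
  the \<open>j\<close>-th column \<open>x\<close> of the inverse, whose recursion
  \<open>x\<^sub>i = \<delta>\<^sub>i\<^sub>j + w (\<Sum>k. \<alpha>\<^sub>i\<^sub>k x\<^sub>k)\<close> involves the rows. Triangularity makes \<open>x\<close> vanish above \<open>j\<close>, so
  \<open>x\<^sub>j = 1\<close>, and below \<open>j\<close> each entry is \<open>w\<close> times a subconvex combination of earlier ones
  (lemma \<open>norm_resolvent_column_le_1\<close>). Finally \<open>Q\<^sub>j\<close> is once more \<open>w\<close> times such a combination of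
  the entries of \<open>x\<close>.
\<close>

lemma norm_subconvex_combination_le_1:
  fixes a :: "nat \<Rightarrow> real" and x :: "nat \<Rightarrow> complex"
  assumes "\<And>k. k < n \<Longrightarrow> a k \<ge> 0" and "(\<Sum>k<n. a k) \<le> 1"
    and x: "\<And>k. k < n \<Longrightarrow> a k \<noteq> 0 \<Longrightarrow> cmod (x k) \<le> 1"
    and "cmod w \<le> 1"
  shows "cmod (w * (\<Sum>k<n. of_real (a k) * x k)) \<le> 1"
proof -
  have "cmod (\<Sum>k<n. of_real (a k) * x k) \<le> (\<Sum>k<n. a k)"
  proof (rule sum_norm_le)
    fix k assume "k \<in> {..<n}"
    then show "cmod (of_real (a k) * x k) \<le> a k"
      using assms(1)[of k] x[of k]
      by (cases "a k = 0") (auto simp: norm_mult mult_left_le)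
  qed
  with assms(2) have "cmod (\<Sum>k<n. of_real (a k) * x k) \<le> 1" by linarith
  with \<open>cmod w \<le> 1\<close> show ?thesis
    by (simp add: norm_mult mult_le_one)
qed

text \<open>
  The hypothesis on \<open>x\<close> is the componentwise form of \<open>(I - w A) x = e\<^sub>j\<close>. The vanishing of the
  entries before \<open>j\<close> has to be proved first: it is what prevents the entry \<open>x\<^sub>j\<close> from picking up
  a contribution on top of the 1 coming from \<open>e\<^sub>j\<close>.
\<close>

lemma norm_resolvent_column_le_1:
  fixes A :: "nat \<Rightarrow> nat \<Rightarrow> real" and x :: "nat \<Rightarrow> complex"
  assumes nonneg: "\<And>i k. i < n \<Longrightarrow> k < n \<Longrightarrow> A i k \<ge> 0"
    and rows: "\<And>i. i < n \<Longrightarrow> (\<Sum>k<n. A i k) \<le> 1"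
    and lower: "\<And>i k. i < n \<Longrightarrow> k < n \<Longrightarrow> i \<le> k \<Longrightarrow> A i k = 0"
    and w: "cmod w \<le> 1"
    and x: "\<And>i. i < n \<Longrightarrow> x i = (if i = j then 1 else 0) + w * (\<Sum>k<n. of_real (A i k) * x k)"
    and "i < n"
  shows "cmod (x i) \<le> 1"
proof -
  have zero: "x i = 0" if "i < n" "i < j" for i
    using that
  proof (induction i rule: less_induct)
    case (less i)
    have "of_real (A i k) * x k = 0" if "k < n" for k
      using lower[of i k] less that by (cases "i \<le> k") auto
    with x[of i] less.prems show ?case by simp
  qed
  show ?thesis
    using \<open>i < n\<close>
  proof (induction i rule: less_induct)
    case (less i)
    show ?case
    proof (cases "i = j")
      case True
      have "of_real (A i k) * x k = 0" if "k < n" for k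
        using lower[of i k] zero[of k] less.prems that True by (cases "i \<le> k") auto
      then have "(\<Sum>k<n. of_real (A i k) * x k) = 0" by (intro sum.neutral) auto
      with x[of i] less.prems True show ?thesis by simp
    next
      case False
      have "cmod (w * (\<Sum>k<n. of_real (A i k) * x k)) \<le> 1"
      proof (rule norm_subconvex_combination_le_1)
        fix k assume "k < n" "A i k \<noteq> 0"
        with lower[of i k] less.prems have "k < i" by (meson not_le)
        with less.IH \<open>k < n\<close> show "cmod (x k) \<le> 1" by blast
      qed (use less.prems nonneg rows w in auto)
      with x[of i] less.prems False show ?thesis by simp
    qed
  qed
qed

lemma internal_stability_functions_le_1:
  assumes C: "C > 0" and canonical: "canonical_shu_osher s C \<alpha> \<beta>"
    and z: "z \<in> ssp_disk C" and j: "j < s"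
  shows "cmod (internal_stability_functions s \<alpha> \<beta> z $ j) \<le> 1"
proof -
  define w where "w = 1 + z / of_real C"
  have "w = (z + of_real C) / of_real C"
    using C by (simp add: w_def add_divide_distrib)
  with C have "cmod w = cmod (z + of_real C) / C"
    by (simp add: norm_divide)
  with z C have w: "cmod w \<le> 1" by (simp add: ssp_disk_def)
  have explicit: "explicit_shu_osher s \<alpha> \<beta>"
    and nonneg: "\<And>i k. i < s + 1 \<Longrightarrow> k < s + 1 \<Longrightarrow> \<alpha> $$ (i, k) \<ge> 0"
    and rows': "\<And>i. i < s + 1 \<Longrightarrow> (\<Sum>k<s + 1. \<alpha> $$ (i, k)) \<le> 1"
    and \<alpha>: "\<alpha> = C \<cdot>\<^sub>m \<beta>"
    using canonical by (auto simp: canonical_shu_osher_def)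
  have rows: "(\<Sum>k<s. \<alpha> $$ (i, k)) \<le> 1" if "i < s + 1" for i
    using rows'[OF that] nonneg[OF that, of s] by simp
  have lower: "\<alpha> $$ (i, k) = 0" if "i < s" "k < s" "i \<le> k" for i k
    using explicit that by (auto simp: explicit_shu_osher_def strictly_lower_triangular_def)
  have \<beta>: "z * of_real (\<beta> $$ (i, k)) = (w - 1) * of_real (\<alpha> $$ (i, k))"
    if "i < s + 1" "k < s + 1" for i k
    using explicit that C by (auto simp: \<alpha> w_def explicit_shu_osher_def)

  let ?M = "stage_matrix s \<alpha> \<beta> z"
  have M: "?M \<in> carrier_mat s s"
    by (auto simp: stage_matrix_def stage_block_def)
  obtain N where N: "mat_inverse ?M = Some N"
    using mat_inverse_stage_matrix[OF explicit] by blast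
  have MN: "?M * N = 1\<^sub>m s" and dim: "N \<in> carrier_mat s s"
    using mat_inverse(2)[OF M N] by auto
  have entry: "?M $$ (i, k) = (if i = k then 1 else 0) - w * of_real (\<alpha> $$ (i, k))"
    if "i < s" "k < s" for i k
    using that \<beta>[of i k] by (simp add: stage_matrix_def stage_block_def algebra_simps)
  have column: "N $$ (i, j) = (if i = j then 1 else 0) +
      w * (\<Sum>k<s. of_real (\<alpha> $$ (i, k)) * N $$ (k, j))" if i: "i < s" for i
  proof -
    have "(if i = j then 1 else 0) = (?M * N) $$ (i, j)"
      using i j by (simp add: MN)
    also have "\<dots> = (\<Sum>k<s. ?M $$ (i, k) * N $$ (k, j))"
      using i j M dim by (simp add: scalar_prod_def atLeast0LessThan)
    also have "\<dots> = (\<Sum>k<s. (if i = k then N $$ (k, j) else 0)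
        - w * (of_real (\<alpha> $$ (i, k)) * N $$ (k, j)))"
      using i by (intro sum.cong) (auto simp: entry algebra_simps)
    also have "\<dots> = N $$ (i, j) - w * (\<Sum>k<s. of_real (\<alpha> $$ (i, k)) * N $$ (k, j))"
      using i by (simp add: sum_subtractf sum_distrib_left)
    finally show ?thesis by simp
  qed
  have bound: "cmod (N $$ (i, j)) \<le> 1" if "i < s" for i
    by (rule norm_resolvent_column_le_1[where A = "\<lambda>i k. \<alpha> $$ (i, k)" and j = j and w = w
          and x = "\<lambda>i. N $$ (i, j)" and n = s])
       (use nonneg rows lower w column that in auto)

  have "internal_stability_functions s \<alpha> \<beta> z $ j =
      (\<Sum>k<s. (of_real (\<alpha> $$ (s, k)) + z * of_real (\<beta> $$ (s, k))) * N $$ (k, j))"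
    using j dim
    by (simp add: internal_stability_functions_def N scalar_prod_def last_row_def
        mat_of_row_def atLeast0LessThan)
  also have "\<dots> = w * (\<Sum>k<s. of_real (\<alpha> $$ (s, k)) * N $$ (k, j))"
    unfolding sum_distrib_left by (intro sum.cong) (auto simp: \<beta> algebra_simps)
  also have "cmod \<dots> \<le> 1"
    by (rule norm_subconvex_combination_le_1) (use nonneg rows bound w in auto)
  finally show ?thesis .
qed

theorem theorem3p2:
  fixes s :: nat and C :: real and \<alpha> \<beta> :: "real mat"
  assumes "s \<ge> 1"
    and "C > 0"
    and "canonical_shu_osher s C \<alpha> \<beta>"
  shows "max_internal_amplification s \<alpha> \<beta> (ssp_disk C) \<le> 1"
proof -
  have "(SUP z\<in>ssp_disk C. ennreal (cmod (internal_stability_functions s \<alpha> \<beta> z $ j))) \<le> 1"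
    if "j < s" for j
    using internal_stability_functions_le_1[OF assms(2,3) _ that]
    by (intro SUP_least) (simp add: ennreal_le_1)
  with \<open>s \<ge> 1\<close> show ?thesis
    unfolding max_internal_amplification_def by (subst Max_le_iff) (auto simp: lessThan_empty_iff)
qed

end
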